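(* For any graph $G$ with no isolated vertex and any nontrivial graph $H$, $$\max\{\gamma_t(G),2\rho(G)\}\leq \gamma_{\times 2}(G\circ H)\leq 2\gamma_t(G).$$
   Context: All graphs are finite, undirected, without loops or multiple edges, and have at least one vertex; a graph is nontrivial if it has at least two vertices. $N[v]$ denotes the closed neighbourhood of $v$ ($v$ together with its neighbours). The lexicographic product $G\circ H$ has vertex set $V(G)\times V(H)$, and $(u,v)$ is adjacent to $(x,y)$ if and only if $ux\in E(G)$, or $u=x$ and $vy\in E(H)$. A vertex dominates itself and its neighbours. For a graph $F$ with no isolated vertex, $\gamma_{\times 2}(F)$ is the minimum cardinality of a double dominating set of $F$, i.e. a set $S\subseteq V(F)$ such that every vertex of $F$ is dominated by at least two vertices of $S$; $\gamma_t(F)$ is the minimum cardinality of a total dominating set of $F$, i.e. a set $S\subseteq V(F)$ such that every vertex of $F$ (including those in $S$) has a neighbour in $S$. A $2$-packing of $G$ is a set $X\subseteq V(G)$ such that $N[u]\cap N[v]=\emptyset$ for every pair of different vertices $u,v\in X$; $\rho(G)$ is the maximum cardinality of a $2$-packing of $G$. *)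

theory Defs
  imports "Graph_Theory.Pair_Digraph"
begin

text \<open>
  Finite simple undirected graphs are the \<open>pair_graph\<close>s of the Graph_Theory entry: finite,
  symmetric, loop-free, with an edge \<open>uv\<close> represented by both pairs \<open>(u, v)\<close> and \<open>(v, u)\<close>.
  That locale admits the null graph, so nonemptiness of the vertex set has to be assumed
  separately.
\<close>

definition nbhd :: "'a pair_pre_digraph \<Rightarrow> 'a \<Rightarrow> 'a set" where
  "nbhd G v = {u. (v, u) \<in> parcs G}"

definition closed_nbhd :: "'a pair_pre_digraph \<Rightarrow> 'a \<Rightarrow> 'a set" where
  "closed_nbhd G v = insert v (nbhd G v)"

definition no_isolated_vertex :: "'a pair_pre_digraph \<Rightarrow> bool" where
  "no_isolated_vertex G \<longleftrightarrow> (\<forall>v \<in> pverts G. nbhd G v \<noteq> {})"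

definition nontrivial :: "'a pair_pre_digraph \<Rightarrow> bool" where
  "nontrivial G \<longleftrightarrow> card (pverts G) \<ge> 2"

definition lex_product ::
  "'a pair_pre_digraph \<Rightarrow> 'b pair_pre_digraph \<Rightarrow> ('a \<times> 'b) pair_pre_digraph" where
  "lex_product G H =
     \<lparr> pverts = pverts G \<times> pverts H,
       parcs = {((u, v), (x, y)) | u v x y.
                  (u, v) \<in> pverts G \<times> pverts H \<and> (x, y) \<in> pverts G \<times> pverts H \<and>
                  ((u, x) \<in> parcs G \<or> u = x \<and> (v, y) \<in> parcs H)} \<rparr>"

text \<open>
  The vertices dominating \<open>v\<close> are exactly those of \<open>closed_nbhd G v\<close>, by symmetry of adjacency.
\<close>

definition double_dominating_set :: "'a pair_pre_digraph \<Rightarrow> 'a set \<Rightarrow> bool" where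
  "double_dominating_set G S \<longleftrightarrow>
     S \<subseteq> pverts G \<and> (\<forall>v \<in> pverts G. card (closed_nbhd G v \<inter> S) \<ge> 2)"

definition total_dominating_set :: "'a pair_pre_digraph \<Rightarrow> 'a set \<Rightarrow> bool" where
  "total_dominating_set G S \<longleftrightarrow>
     S \<subseteq> pverts G \<and> (\<forall>v \<in> pverts G. \<exists>u \<in> S. u \<in> nbhd G v)"

definition two_packing :: "'a pair_pre_digraph \<Rightarrow> 'a set \<Rightarrow> bool" where
  "two_packing G X \<longleftrightarrow>
     X \<subseteq> pverts G \<and>
     (\<forall>u \<in> X. \<forall>v \<in> X. u \<noteq> v \<longrightarrow> closed_nbhd G u \<inter> closed_nbhd G v = {})"

text \<open>
  \<open>Min\<close> and \<open>Max\<close> are meaningful on finite nonempty sets only; the lemmas below show that this is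
  so for graphs without isolated vertices (for the packing number: for all graphs).
\<close>

definition double_domination_number :: "'a pair_pre_digraph \<Rightarrow> nat" where
  "double_domination_number G = Min {card S | S. double_dominating_set G S}"

definition total_domination_number :: "'a pair_pre_digraph \<Rightarrow> nat" where
  "total_domination_number G = Min {card S | S. total_dominating_set G S}"

definition packing_number :: "'a pair_pre_digraph \<Rightarrow> nat" where
  "packing_number G = Max {card X | X. two_packing G X}"

lemma finite_card_subsets:
  assumes "finite V" and "\<And>S. P S \<Longrightarrow> S \<subseteq> V"
  shows "finite {card S | S. P S}"
proof (rule finite_subset)
  show "{card S | S. P S} \<subseteq> card ` Pow V" using assms(2) by auto
  show "finite (card ` Pow V)" using assms(1) by simp
qed

lemma nbhd_subset_pverts:
  assumes "pair_graph G"
  shows "nbhd G v \<subseteq> pverts G"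
proof -
  interpret pair_graph G by fact
  show ?thesis by (auto simp: nbhd_def dest: in_arcsD2)
qed

lemma total_domination_number_wf:
  assumes "pair_graph G" "no_isolated_vertex G"
  shows "finite {card S | S. total_dominating_set G S}"
    and "{card S | S. total_dominating_set G S} \<noteq> {}"
proof -
  interpret pair_graph G by fact
  show "finite {card S | S. total_dominating_set G S}"
    by (rule finite_card_subsets[OF pair_finite_verts]) (simp add: total_dominating_set_def)
  have "total_dominating_set G (pverts G)"
    using assms(2) nbhd_subset_pverts[OF assms(1)]
    unfolding total_dominating_set_def no_isolated_vertex_def by blast
  then show "{card S | S. total_dominating_set G S} \<noteq> {}" by blast
qed

lemma double_domination_number_wf:
  assumes "pair_graph G" "no_isolated_vertex G"
  shows "finite {card S | S. double_dominating_set G S}"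
    and "{card S | S. double_dominating_set G S} \<noteq> {}"
proof -
  interpret pair_graph G by fact
  show "finite {card S | S. double_dominating_set G S}"
    by (rule finite_card_subsets[OF pair_finite_verts]) (simp add: double_dominating_set_def)
  have "card (closed_nbhd G v \<inter> pverts G) \<ge> 2" if v: "v \<in> pverts G" for v
  proof -
    obtain u where u: "(v, u) \<in> parcs G"
      using assms(2) v by (auto simp: no_isolated_vertex_def nbhd_def)
    then have "u \<in> pverts G" "v \<noteq> u" by (auto dest: in_arcsD2 pair_no_loops)
    then have "{v, u} \<subseteq> closed_nbhd G v \<inter> pverts G" "card {v, u} = 2"
      using u v by (auto simp: closed_nbhd_def nbhd_def)
    then show ?thesis
      using card_mono[of "closed_nbhd G v \<inter> pverts G" "{v, u}"] pair_finite_verts by simp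
  qed
  then have "double_dominating_set G (pverts G)" by (simp add: double_dominating_set_def)
  then show "{card S | S. double_dominating_set G S} \<noteq> {}" by blast
qed

lemma packing_number_wf:
  assumes "pair_graph G"
  shows "finite {card X | X. two_packing G X}"
    and "{card X | X. two_packing G X} \<noteq> {}"
proof -
  interpret pair_graph G by fact
  show "finite {card X | X. two_packing G X}"
    by (rule finite_card_subsets[OF pair_finite_verts]) (simp add: two_packing_def)
  have "two_packing G {}" by (simp add: two_packing_def)
  then show "{card X | X. two_packing G X} \<noteq> {}" by blast
qed

lemma pair_graph_lex_product:
  assumes "pair_graph G" "pair_graph H"
  shows "pair_graph (lex_product G H)"
proof -
  interpret G: pair_graph G by fact
  interpret H: pair_graph H by fact
  let ?P = "lex_product G H"
  have fin: "finite (pverts ?P)"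
    using G.pair_finite_verts H.pair_finite_verts by (simp add: lex_product_def)
  have sub: "parcs ?P \<subseteq> pverts ?P \<times> pverts ?P"
    by (auto simp: lex_product_def)
  have symG: "sym (parcs G)" and symH: "sym (parcs H)"
    using G.pair_sym_arcs H.pair_sym_arcs by (simp_all add: symmetric_def)
  have "sym (parcs ?P)"
    by (rule symI) (auto simp: lex_product_def dest: symD[OF symG] symD[OF symH])
  then have sym: "symmetric (with_proj ?P)" by (simp add: symmetric_def)
  have loop: "fst e \<noteq> snd e" if "e \<in> parcs ?P" for e
    using that by (auto simp: lex_product_def dest: G.pair_no_loops H.pair_no_loops)
  show ?thesis
    using sub finite_subset[OF sub] fin sym loop by unfold_locales auto
qed

lemma no_isolated_vertex_lex_product:
  assumes "pair_graph G" "no_isolated_vertex G"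
  shows "no_isolated_vertex (lex_product G H)"
  unfolding no_isolated_vertex_def
proof
  fix p assume "p \<in> pverts (lex_product G H)"
  then obtain u v where p: "p = (u, v)" "u \<in> pverts G" "v \<in> pverts H"
    by (auto simp: lex_product_def)
  then obtain x where x: "x \<in> nbhd G u" using assms(2) by (auto simp: no_isolated_vertex_def)
  then have "(x, v) \<in> nbhd (lex_product G H) p"
    using p nbhd_subset_pverts[OF assms(1), of u] by (auto simp: nbhd_def lex_product_def)
  then show "nbhd (lex_product G H) p \<noteq> {}" by blast
qed

end

theory Submission
  imports Defs
begin

text \<open>
  For the upper bound, take two copies \<open>D \<times> {a, b}\<close> of a total dominating set \<open>D\<close> of \<open>G\<close>. For the
  lower bounds, let \<open>S\<close> be a double dominating set of the product. Closed neighbourhoods in the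
  product project into closed neighbourhoods of \<open>G\<close>, so a 2-packing of \<open>G\<close> lifts to one of the
  product and each of its members claims two private vertices of \<open>S\<close>. If a vertex \<open>u\<close> of the
  projection \<open>A\<close> of \<open>S\<close> has no neighbour in \<open>A\<close>, then \<open>S\<close> has at least two vertices over \<open>u\<close>;
  hence adding to \<open>A\<close> one neighbour of each such \<open>u\<close> gives a total dominating set of \<open>G\<close> of
  cardinality at most \<open>|S|\<close>.
\<close>

lemma fst_closed_nbhd_lex_product:
  assumes "p \<in> closed_nbhd (lex_product G H) (u, v)"
  shows "fst p \<in> closed_nbhd G u"
  using assms by (auto simp: closed_nbhd_def nbhd_def lex_product_def)

lemma pverts_lex_product: "pverts (lex_product G H) = pverts G \<times> pverts H"
  by (simp add: lex_product_def)

text \<open>A neighbour \<open>d\<close> of \<open>u\<close> in \<open>D\<close> makes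
  \<open>(u, v)\<close> adjacent to both \<open>(d, a)\<close> and \<open>(d, b)\<close>, whatever
  \<open>v\<close> is.\<close>

lemma double_dominating_lex_product_of_total_dominating:
  assumes D: "total_dominating_set G D"
    and ab: "a \<in> pverts H" "b \<in> pverts H" "a \<noteq> b"
    and fin: "finite D"
  shows "double_dominating_set (lex_product G H) (D \<times> {a, b})"
  unfolding double_dominating_set_def
proof (intro conjI ballI)
  show "D \<times> {a, b} \<subseteq> pverts (lex_product G H)"
    using D ab by (auto simp: pverts_lex_product total_dominating_set_def)
  fix p assume "p \<in> pverts (lex_product G H)"
  then obtain u v where p: "p = (u, v)" "u \<in> pverts G" "v \<in> pverts H"
    by (auto simp: pverts_lex_product)
  obtain d where d: "d \<in> D" "(u, d) \<in> parcs G" "d \<in> pverts G"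
    using D p(2) unfolding total_dominating_set_def nbhd_def by blast
  have "{(d, a), (d, b)} \<subseteq> closed_nbhd (lex_product G H) p \<inter> (D \<times> {a, b})"
    using p d ab by (auto simp: closed_nbhd_def nbhd_def lex_product_def)
  then have "card {(d, a), (d, b)} \<le> card (closed_nbhd (lex_product G H) p \<inter> (D \<times> {a, b}))"
    using fin by (intro card_mono) auto
  then show "2 \<le> card (closed_nbhd (lex_product G H) p \<inter> (D \<times> {a, b}))"
    using ab(3) by simp
qed

text \<open>The sets \<open>closed_nbhd F x \<inter> S\<close> for \<open>x\<close> in
  \<open>X\<close> are pairwise disjoint and have at least two elements each.\<close>

lemma double_dominating_card_ge_two_packing:
  assumes S: "double_dominating_set F S" and X: "two_packing F X" and fin: "finite (pverts F)"
  shows "2 * card X \<le> card S"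
proof -
  have finS: "finite S" and finX: "finite X"
    using S X fin by (auto simp: double_dominating_set_def two_packing_def intro: finite_subset)
  have "2 * card X = (\<Sum>x\<in>X. 2)" by simp
  also have "\<dots> \<le> (\<Sum>x\<in>X. card (closed_nbhd F x \<inter> S))"
    using S X by (intro sum_mono) (auto simp: double_dominating_set_def two_packing_def)
  also have "\<dots> = card (\<Union>x\<in>X. closed_nbhd F x \<inter> S)"
    using X finX finS by (intro card_UN_disjoint[symmetric]) (auto simp: two_packing_def)
  also have "\<dots> \<le> card S" using finS by (intro card_mono) auto
  finally show ?thesis .
qed

text \<open>A vertex common to two closed neighbourhoods in the product would project to one common
  to those of \<open>x\<close> and \<open>y\<close> in \<open>G\<close>. A single layer
  \<open>h\<close> is used because vertices over the same \<open>x\<close> share all neighbours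
  lying over neighbours of \<open>x\<close>.\<close>

lemma two_packing_lex_product:
  assumes X: "two_packing G X" and h: "h \<in> pverts H"
  shows "two_packing (lex_product G H) (X \<times> {h})"
proof -
  have "closed_nbhd (lex_product G H) (x, h) \<inter> closed_nbhd (lex_product G H) (y, h) = {}"
    if "x \<in> X" "y \<in> X" "x \<noteq> y" for x y
    using X that fst_closed_nbhd_lex_product[of _ G H] unfolding two_packing_def by blast
  then show ?thesis
    using X h by (auto simp: two_packing_def pverts_lex_product)
qed

text \<open>Count \<open>S\<close> fibre by fibre: each fibre over the image contributes at least
  one element, and each fibre over \<open>I\<close> at least one more.\<close>

lemma card_fibres_ge:
  assumes fin: "finite S" and I: "I \<subseteq> f ` S"
    and two: "\<And>u. u \<in> I \<Longrightarrow> 2 \<le> card {p \<in> S. f p = u}"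
  shows "card (f ` S) + card I \<le> card S"
proof -
  let ?fib = "\<lambda>u. {p \<in> S. f p = u}"
  have "card I = (\<Sum>u\<in>f ` S. if u \<in> I then 1 else 0)"
    using fin I by (simp add: sum.If_cases Int_absorb1)
  then have "card (f ` S) + card I = (\<Sum>u\<in>f ` S. 1 + (if u \<in> I then 1 else 0))"
    by (simp only: sum.distrib card_eq_sum)
  also have "\<dots> \<le> (\<Sum>u\<in>f ` S. card (?fib u))"
  proof (rule sum_mono)
    fix u assume "u \<in> f ` S"
    then have "?fib u \<noteq> {}" by auto
    then have "1 \<le> card (?fib u)" using fin by (simp add: Suc_le_eq card_gt_0_iff)
    then show "1 + (if u \<in> I then 1 else 0) \<le> card (?fib u)"
      using two[of u] by auto
  qed
  also have "\<dots> = card S" using sum.image_gen[OF fin, of "\<lambda>_. 1::nat" f] by (simp only: card_eq_sum)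
  finally show ?thesis .
qed

lemma total_dominating_of_double_dominating_lex_product:
  assumes G: "pair_graph G" "no_isolated_vertex G"
    and H: "pair_graph H" "pverts H \<noteq> {}"
    and S: "double_dominating_set (lex_product G H) S"
  obtains T where "total_dominating_set G T" "card T \<le> card S"
proof -
  interpret G: pair_graph G by fact
  interpret H: pair_graph H by fact
  let ?A = "fst ` S"
  define I where "I = {u \<in> ?A. nbhd G u \<inter> ?A = {}}"
  define f where "f u = (SOME w. w \<in> nbhd G u)" for u
  have f: "f u \<in> nbhd G u" if "u \<in> pverts G" for u
    using G(2) that by (auto simp: f_def no_isolated_vertex_def some_in_eq)
  obtain h where h: "h \<in> pverts H" using H(2) by auto
  have SV: "S \<subseteq> pverts G \<times> pverts H"
    using S by (simp add: double_dominating_set_def pverts_lex_product)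
  then have finS: "finite S"
    using G.pair_finite_verts H.pair_finite_verts by (meson finite_SigmaI finite_subset)
  have AV: "?A \<subseteq> pverts G" using SV by auto
  have dominated: "2 \<le> card (closed_nbhd (lex_product G H) (u, h) \<inter> S)" if "u \<in> pverts G" for u
    using S that h by (auto simp: double_dominating_set_def pverts_lex_product)
  have fibre: "2 \<le> card {p \<in> S. fst p = u}" if "u \<in> pverts G" "nbhd G u \<inter> ?A = {}" for u
  proof -
    \<comment> \<open>Vertices of \<open>S\<close> project into \<open>?A\<close>, which misses
      \<open>nbhd G u\<close>; so those dominating \<open>(u, h)\<close> can only lie over
      \<open>u\<close> itself.\<close>
    have "closed_nbhd (lex_product G H) (u, h) \<inter> S \<subseteq> {p \<in> S. fst p = u}"
    proof
      fix p assume p: "p \<in> closed_nbhd (lex_product G H) (u, h) \<inter> S"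
      then have "fst p \<in> closed_nbhd G u" by (auto intro: fst_closed_nbhd_lex_product)
      then show "p \<in> {p \<in> S. fst p = u}" using p that(2) by (auto simp: closed_nbhd_def)
    qed
    then have "card (closed_nbhd (lex_product G H) (u, h) \<inter> S) \<le> card {p \<in> S. fst p = u}"
      using finS by (intro card_mono) auto
    then show ?thesis using dominated[OF that(1)] by linarith
  qed
  \<comment> \<open>Membership of \<open>u\<close> in \<open>?A\<close> is not assumed: it follows
    because the fibre over \<open>u\<close> is nonempty. So \<open>I\<close> contains every vertex
    of \<open>G\<close> that \<open>?A\<close> fails to dominate totally.\<close>
  have undominated_in_I: "u \<in> I" if u: "u \<in> pverts G" "nbhd G u \<inter> ?A = {}" for u
  proof -
    have "{p \<in> S. fst p = u} \<noteq> {}" using fibre[OF u] by (metis card.empty not_numeral_le_zero)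
    then show ?thesis using u by (force simp: I_def)
  qed
  have "total_dominating_set G (?A \<union> f ` I)"
    unfolding total_dominating_set_def
  proof (intro conjI ballI)
    show "?A \<union> f ` I \<subseteq> pverts G"
      using AV f nbhd_subset_pverts[OF G(1)] by (auto simp: I_def)
    fix v assume v: "v \<in> pverts G"
    \<comment> \<open>Either \<open>v\<close> has a neighbour in \<open>?A\<close>, or
      \<open>v\<close> lies in \<open>I\<close> and \<open>f v\<close> serves.\<close>
    show "\<exists>u\<in>?A \<union> f ` I. u \<in> nbhd G v"
      using undominated_in_I[OF v] f[OF v] by blast
  qed
  moreover have "card (?A \<union> f ` I) \<le> card S"
  proof -
    have "finite I" using finS by (simp add: I_def)
    have "card (?A \<union> f ` I) \<le> card ?A + card (f ` I)" by (rule card_Un_le)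
    also have "\<dots> \<le> card ?A + card I" using card_image_le[OF \<open>finite I\<close>] by simp
    \<comment> \<open>The second element of each fibre over \<open>I\<close> pays for the added
      neighbour.\<close>
    also have "\<dots> \<le> card S"
      using AV by (intro card_fibres_ge[OF finS] fibre) (auto simp: I_def)
    finally show ?thesis .
  qed
  ultimately show thesis by (rule that)
qed

theorem theorem2p2:
  fixes G :: "'a pair_pre_digraph" and H :: "'b pair_pre_digraph"
  assumes "pair_graph G" and "pverts G \<noteq> {}" and "no_isolated_vertex G"
    and "pair_graph H" and "nontrivial H"
  shows "max (total_domination_number G) (2 * packing_number G)
           \<le> double_domination_number (lex_product G H)
         \<and> double_domination_number (lex_product G H) \<le> 2 * total_domination_number G"
proof -
  let ?P = "lex_product G H"
  interpret P: pair_graph ?P by (rule pair_graph_lex_product) fact+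
  interpret G: pair_graph G by fact
  note wfT = total_domination_number_wf[OF assms(1,3)]
  note wfX = packing_number_wf[OF assms(1)]
  note wfS = double_domination_number_wf[OF P.pair_graph_axioms
      no_isolated_vertex_lex_product[OF assms(1,3)]]
  obtain a b where ab: "a \<in> pverts H" "b \<in> pverts H" "a \<noteq> b"
  proof -
    from assms(5) have "Suc (Suc 0) \<le> card (pverts H)" by (simp add: nontrivial_def)
    then show thesis using that by (auto simp: card_le_Suc_iff)
  qed
  obtain S where S: "double_dominating_set ?P S" "double_domination_number ?P = card S"
    using Min_in[OF wfS] by (auto simp: double_domination_number_def)
  obtain D where D: "total_dominating_set G D" "total_domination_number G = card D"
    using Min_in[OF wfT] by (auto simp: total_domination_number_def)
  obtain X where X: "two_packing G X" "packing_number G = card X"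
    using Max_in[OF wfX] by (auto simp: packing_number_def)
  have "total_domination_number G \<le> card S"
  proof -
    obtain T where T: "total_dominating_set G T" "card T \<le> card S"
      using total_dominating_of_double_dominating_lex_product[OF assms(1,3,4) _ S(1)] ab(1)
      by blast
    have "total_domination_number G \<le> card T"
      unfolding total_domination_number_def using wfT(1) T(1) by (intro Min_le) auto
    then show ?thesis using T(2) by linarith
  qed
  moreover have "2 * card X \<le> card S"
    using double_dominating_card_ge_two_packing
      [OF S(1) two_packing_lex_product[OF X(1) ab(1)] P.pair_finite_verts]
    by (simp add: card_cartesian_product)
  moreover have "double_domination_number ?P \<le> 2 * card D"
  proof -
    have "finite D"
      using D(1) G.pair_finite_verts by (auto simp: total_dominating_set_def intro: finite_subset)
    then have "double_domination_number ?P \<le> card (D \<times> {a, b})"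
      unfolding double_domination_number_def
      using wfS(1) double_dominating_lex_product_of_total_dominating[OF D(1) ab]
      by (intro Min_le) blast+
    also have "\<dots> = 2 * card D" using ab(3) by (simp add: card_cartesian_product)
    finally show ?thesis .
  qed
  ultimately show ?thesis using S(2) D(2) X(2) by simp
qed

end
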